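(* Let $d\ge 1$ be an integer, and let $c:\mathbb{R}^d\times\mathbb{R}^d\to\mathbb{R}$ be the Euclidean Caprac coupling: $c(x,y)=\langle x,y\rangle/\|x\|$ if $x\neq 0$, and $c(0,y)=0$. Let $k\in\{0,1,\ldots,d\}$. Then $$\big(\delta_{\ell_0^{\le k}}\big)^{-c}=\big(\delta_{\ell_0^{\le k}}\big)^{c}=\|\cdot\|_{(k)}^{\mathrm{sgn}},$$ $$\big(\delta_{\ell_0^{\le k}}\big)^{cc'}=\delta_{\ell_0^{\le k}},$$ $$\ell_0^{\,c}=\sup_{l=0,1,\ldots,d}\Big[\|\cdot\|_{(l)}^{\mathrm{sgn}}-l\Big],$$ $$\ell_0^{\,cc'}=\ell_0,$$ with the convention that $\|\cdot\|_{(0)}^{\mathrm{sgn}}=0$.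
   Context: $\mathbb{R}^d$ carries the standard scalar product $\langle\cdot,\cdot\rangle$ and the Euclidean norm $\|\cdot\|$. Write $\overline{\mathbb{R}}=[-\infty,+\infty]$. The function $\ell_0:\mathbb{R}^d\to\{0,1,\ldots,d\}$ is the $l_0$ pseudonorm: $\ell_0(x)$ is the number of nonzero components of $x$. Its level sets are $\ell_0^{\le k}=\{x\in\mathbb{R}^d : \ell_0(x)\le k\}$. For a set $Z$, $\delta_Z$ is the characteristic function: $\delta_Z(z)=0$ if $z\in Z$ and $\delta_Z(z)=+\infty$ otherwise. For $K\subset\{1,\ldots,d\}$ and $x\in\mathbb{R}^d$, $x_K\in\mathbb{R}^d$ is the vector with the same components as $x$ for indices in $K$ and zero components outside $K$; $|K|$ is the cardinality of $K$. For $k\in\{1,\ldots,d\}$, the $2$-$k$-symmetric gauge norm is $\|x\|_{(k)}^{\mathrm{sgn}}=\sup_{|K|\le k}\|x_K\|$ (supremum over $K\subset\{1,\ldots,d\}$ with $|K|\le k$). Conjugates: for $f:\mathbb{R}^d\to\overline{\mathbb{R}}$ and a coupling $b:\mathbb{R}^d\times\mathbb{R}^d\to\mathbb{R}$ (here $b=c$ or $b=-c$), $f^{b}(y)=\sup_{x\in\mathbb{R}^d}\big(b(x,y)-f(x)\big)$ for $y\in\mathbb{R}^d$. The biconjugate is $f^{cc'}(x)=\sup_{y\in\mathbb{R}^d}\big(c(x,y)-f^{c}(y)\big)$ for $x\in\mathbb{R}^d$. (Since the couplings are finite-valued, no $(+\infty)+(-\infty)$ ambiguity occurs.) *)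

theory Defs
  imports "HOL-Analysis.Analysis"
begin

definition l0 :: "real ^ 'n \<Rightarrow> nat"
  where "l0 x = card {i. x $ i \<noteq> 0}"

definition l0_level :: "nat \<Rightarrow> (real ^ 'n) set"
  where "l0_level k = {x. l0 x \<le> k}"

text \<open>Characteristic function in the sense of convex analysis, with values 0 and \<open>\<infinity>\<close>.\<close>

definition char_fun :: "'a set \<Rightarrow> 'a \<Rightarrow> ereal"
  where "char_fun Z z = (if z \<in> Z then 0 else \<infinity>)"

definition vec_restrict :: "real ^ 'n \<Rightarrow> 'n set \<Rightarrow> real ^ 'n"
  where "vec_restrict x K = (\<chi> i. if i \<in> K then x $ i else 0)"

text \<open>The 2-\<open>k\<close>-symmetric gauge norm. The supremum is over a finite nonempty set of reals; for
  \<open>k = 0\<close> only the empty index set remains, which yields the usual convention that the value is 0.\<close>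

definition sgn_norm :: "nat \<Rightarrow> real ^ 'n \<Rightarrow> real"
  where "sgn_norm k x = (SUP K\<in>{K. card K \<le> k}. norm (vec_restrict x K))"

lemma sgn_norm_0:
  fixes x :: "real ^ 'n"
  shows "sgn_norm 0 x = 0"
proof -
  have "{K :: 'n set. card K \<le> 0} = {{}}"
    by auto
  moreover have "vec_restrict x {} = 0"
    by (simp add: vec_restrict_def vec_eq_iff)
  ultimately show ?thesis
    by (simp add: sgn_norm_def)
qed

definition conjugate :: "('a \<Rightarrow> 'b \<Rightarrow> real) \<Rightarrow> ('a \<Rightarrow> ereal) \<Rightarrow> 'b \<Rightarrow> ereal"
  where "conjugate b f y = (SUP x. ereal (b x y) - f x)"

definition biconjugate :: "('a \<Rightarrow> 'b \<Rightarrow> real) \<Rightarrow> ('a \<Rightarrow> ereal) \<Rightarrow> 'a \<Rightarrow> ereal"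
  where "biconjugate b f x = (SUP y. ereal (b x y) - conjugate b f y)"

definition caprac :: "real ^ 'n \<Rightarrow> real ^ 'n \<Rightarrow> real"
  where "caprac x y = (if x = 0 then 0 else inner x y / norm x)"

end

theory Submission
  imports Defs
begin

text \<open>
  On the level set of \<open>l\<close>, Cauchy-Schwarz on the support of \<open>x\<close> bounds \<open>c(x, y)\<close> by the gauge norm of \<open>y\<close>
  of index \<open>l\<close>, with equality at \<open>x = y\<^sub>K\<close> for an optimal \<open>K\<close>; this computes both conjugates. For the
  biconjugates, test \<open>x\<close> against \<open>y = t x\<close>: then \<open>c(x, t x) = t \<parallel>x\<parallel>\<close>, whereas the gauge norm of \<open>t x\<close> of
  any index \<open>l < \<ell>\<^sub>0(x)\<close> is \<open>t\<close> times a number strictly smaller than \<open>\<parallel>x\<parallel>\<close>, so that a large \<open>t\<close> separates.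
\<close>

section \<open>Conjugation for an arbitrary finite coupling\<close>

lemma conjugate_upper: "ereal (b x y) - f x \<le> conjugate b f y"
  unfolding conjugate_def by (rule SUP_upper) simp

lemma biconjugate_upper: "ereal (b x y) - conjugate b f y \<le> biconjugate b f x"
  unfolding biconjugate_def by (rule SUP_upper) simp

text \<open>A rearranged Fenchel-Young inequality. Infinite values do no harm since
  \<open>b x y\<close> is finite: \<open>f x = -\<infinity>\<close> forces the conjugate at
  \<open>y\<close> to be \<open>\<infinity>\<close>.\<close>

lemma biconjugate_le: "biconjugate b f x \<le> f x"
  unfolding biconjugate_def
proof (rule SUP_least)
  fix y
  show "ereal (b x y) - conjugate b f y \<le> f x"
    using conjugate_upper[of b x y f]
    by (cases "f x"; cases "conjugate b f y") auto
qed

section \<open>Supports and restriction to an index set\<close>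

lemma l0_minus: "l0 (- x) = l0 x"
  by (simp add: l0_def)

lemma l0_le_CARD: "l0 (x :: real ^ 'n) \<le> CARD('n)"
  unfolding l0_def by (rule card_mono) auto

lemma l0_vec_restrict_le: "l0 (vec_restrict x K) \<le> card K"
  unfolding l0_def by (rule card_mono) (auto simp: vec_restrict_def)

lemma vec_restrict_support: "vec_restrict x {i. x $ i \<noteq> 0} = x"
  by (simp add: vec_restrict_def vec_eq_iff)

lemma vec_restrict_scaleR: "vec_restrict (t *\<^sub>R x) K = t *\<^sub>R vec_restrict x K"
  by (simp add: vec_restrict_def vec_eq_iff)

lemma inner_vec_restrict: "inner (vec_restrict x K) y = inner x (vec_restrict y K)"
  unfolding inner_vec_def vec_restrict_def by (rule sum.cong) auto

lemma vec_restrict_idem: "vec_restrict (vec_restrict x K) K = vec_restrict x K"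
  by (simp add: vec_restrict_def vec_eq_iff)

lemma norm_vec_restrict_le: "norm (vec_restrict x K) \<le> norm x"
  by (rule norm_le_componentwise_cart) (simp add: vec_restrict_def)

lemma norm_vec_restrict_less:
  assumes "card K < l0 x"
  shows "norm (vec_restrict x K) < norm x"
proof -
  \<comment> \<open>\<open>K\<close> is too small to contain the support, so restriction loses the
    positive square of some component.\<close>
  have "\<not> {i. x $ i \<noteq> 0} \<subseteq> K"
    using assms card_mono[of K "{i. x $ i \<noteq> 0}"] by (auto simp: l0_def)
  then obtain i where i: "x $ i \<noteq> 0" "i \<notin> K"
    by auto
  have "(\<Sum>i\<in>UNIV. (norm (vec_restrict x K $ i))\<^sup>2) < (\<Sum>i\<in>UNIV. (norm (x $ i))\<^sup>2)"
    by (rule sum_strict_mono_ex1) (use i in \<open>auto simp: vec_restrict_def\<close>)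
  then show ?thesis
    by (simp add: norm_vec_def L2_set_def)
qed

section \<open>Gauge norms\<close>

lemma norm_vec_restrict_le_sgn_norm:
  fixes x :: "real ^ 'n"
  assumes "card K \<le> k"
  shows "norm (vec_restrict x K) \<le> sgn_norm k x"
  unfolding sgn_norm_def
  by (rule cSUP_upper) (use assms in auto)

lemma sgn_norm_least:
  fixes x :: "real ^ 'n"
  assumes "\<And>K. card K \<le> k \<Longrightarrow> norm (vec_restrict x K) \<le> c"
  shows "sgn_norm k x \<le> c"
  unfolding sgn_norm_def
proof (rule cSUP_least)
  show "{K :: 'n set. card K \<le> k} \<noteq> {}"
    by (auto intro: exI[of _ "{}"])
qed (use assms in auto)

lemma sgn_norm_attained:
  fixes x :: "real ^ 'n"
  obtains K where "card K \<le> k" "sgn_norm k x = norm (vec_restrict x K)"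
proof -
  let ?A = "(\<lambda>K. norm (vec_restrict x K)) ` {K. card K \<le> k}"
  have ne: "?A \<noteq> {}"
    by (auto intro: exI[of _ "{}"])
  have "sgn_norm k x = Max ?A"
    unfolding sgn_norm_def by (rule cSup_eq_Max) (use ne in auto)
  also have "\<dots> \<in> ?A"
    by (rule Max_in) (use ne in auto)
  finally show ?thesis
    using that by auto
qed

lemma sgn_norm_mono:
  assumes "k \<le> l"
  shows "sgn_norm k x \<le> sgn_norm l x"
  using assms by (intro sgn_norm_least norm_vec_restrict_le_sgn_norm) auto

lemma sgn_norm_le_norm: "sgn_norm k x \<le> norm x"
  by (intro sgn_norm_least norm_vec_restrict_le)

text \<open>Strictness survives the supremum because it is attained: there are only finitely many
  index sets.\<close>

lemma sgn_norm_less_norm: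
  assumes "k < l0 x"
  shows "sgn_norm k x < norm x"
  by (metis assms norm_vec_restrict_less order_le_less_trans sgn_norm_attained)

text \<open>This half of positive homogeneity suffices for the lower bounds on biconjugates, where
  the gauge norm is subtracted.\<close>

lemma sgn_norm_scaleR_le:
  assumes "0 \<le> t"
  shows "sgn_norm k (t *\<^sub>R x) \<le> t * sgn_norm k x"
  using assms
  by (intro sgn_norm_least) (simp add: vec_restrict_scaleR mult_left_mono norm_vec_restrict_le_sgn_norm)

section \<open>The coupling against the gauge norms\<close>

lemma caprac_minus_left: "caprac (- x) y = - caprac x y"
  by (simp add: caprac_def)

lemma caprac_scaleR_self: "caprac x (t *\<^sub>R x) = t * norm x"
  by (simp add: caprac_def dot_square_norm power2_eq_square)

lemma caprac_le_sgn_norm: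
  assumes "l0 x \<le> k"
  shows "caprac x y \<le> sgn_norm k y"
proof -
  let ?K = "{i. x $ i \<noteq> 0}"
  have "caprac x y \<le> norm (vec_restrict y ?K)"
  proof (cases "x = 0")
    case False
    \<comment> \<open>\<open>x\<close> is its own restriction to \<open>?K\<close>, and restriction
      is self-adjoint, so it can be moved onto \<open>y\<close>.\<close>
    have "inner x y = inner x (vec_restrict y ?K)"
      using inner_vec_restrict[of x ?K y] by (simp only: vec_restrict_support)
    also have "\<dots> \<le> norm x * norm (vec_restrict y ?K)"
      by (rule norm_cauchy_schwarz)
    finally show ?thesis
      using False by (simp add: caprac_def divide_le_eq mult.commute)
  qed (simp add: caprac_def)
  also have "\<dots> \<le> sgn_norm k y"
    using assms by (intro norm_vec_restrict_le_sgn_norm) (simp add: l0_def)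
  finally show ?thesis .
qed

text \<open>Restriction is an orthogonal projection. If \<open>y\<close> restricts to 0, both sides
  vanish by the convention for the coupling at 0.\<close>

lemma caprac_vec_restrict: "caprac (vec_restrict y K) y = norm (vec_restrict y K)"
proof -
  have "inner (vec_restrict y K) y = (norm (vec_restrict y K))\<^sup>2"
    by (metis inner_vec_restrict vec_restrict_idem dot_square_norm)
  then show ?thesis
    by (simp add: caprac_def power2_eq_square)
qed

lemma caprac_attains_sgn_norm:
  obtains x where "l0 x \<le> k" "caprac x y = sgn_norm k y"
proof -
  obtain K where "card K \<le> k" "sgn_norm k y = norm (vec_restrict y K)"
    by (rule sgn_norm_attained)
  then show ?thesis
    using that[of "vec_restrict y K"] l0_vec_restrict_le[of y K] caprac_vec_restrict[of y K] by simp
qed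

section \<open>Conjugates\<close>

lemma conjugate_char_fun_uminus:
  fixes Z :: "(real ^ 'n) set"
  assumes "\<And>x. - x \<in> Z \<longleftrightarrow> x \<in> Z"
  shows "conjugate (\<lambda>x y. - caprac x y) (char_fun Z) = conjugate caprac (char_fun Z)"
proof
  fix y :: "real ^ 'n"
  \<comment> \<open>The coupling is odd in \<open>x\<close> and \<open>Z\<close> is symmetric, so
    the sign is absorbed by the bijection that sends \<open>x\<close> to \<open>- x\<close>.\<close>
  have *: "ereal (- caprac x y) - char_fun Z x = ereal (caprac (- x) y) - char_fun Z (- x)" for x
    by (simp add: caprac_minus_left char_fun_def assms)
  have "(SUP x. ereal (caprac (- x) y) - char_fun Z (- x)) = (SUP x. ereal (caprac x y) - char_fun Z x)"
    using SUP_image[of "\<lambda>x. ereal (caprac x y) - char_fun Z x" uminus UNIV] by (simp add: o_def surj_uminus)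
  then show "conjugate (\<lambda>x y. - caprac x y) (char_fun Z) y = conjugate caprac (char_fun Z) y"
    unfolding conjugate_def * .
qed

lemma conjugate_char_fun_l0_level:
  "conjugate caprac (char_fun (l0_level k)) y = ereal (sgn_norm k y)"
proof (rule antisym)
  show "conjugate caprac (char_fun (l0_level k)) y \<le> ereal (sgn_norm k y)"
    unfolding conjugate_def
    \<comment> \<open>Off the level set the term is \<open>-\<infinity>\<close>.\<close>
    by (rule SUP_least) (auto simp: char_fun_def l0_level_def intro: caprac_le_sgn_norm)
next
  obtain x where "l0 x \<le> k" "caprac x y = sgn_norm k y"
    by (rule caprac_attains_sgn_norm)
  then show "ereal (sgn_norm k y) \<le> conjugate caprac (char_fun (l0_level k)) y"
    using conjugate_upper[of caprac x y "char_fun (l0_level k)"]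
    by (simp add: char_fun_def l0_level_def)
qed

lemma conjugate_l0:
  fixes y :: "real ^ 'n"
  shows "conjugate caprac (\<lambda>x. ereal (real (l0 x))) y =
    (SUP l\<in>{0..CARD('n)}. ereal (sgn_norm l y) - ereal (real l))"
proof (rule antisym)
  show "conjugate caprac (\<lambda>x. ereal (real (l0 x))) y
      \<le> (SUP l\<in>{0..CARD('n)}. ereal (sgn_norm l y) - ereal (real l))"
    unfolding conjugate_def
  proof (rule SUP_least)
    fix x :: "real ^ 'n"
    show "ereal (caprac x y) - ereal (real (l0 x))
        \<le> (SUP l\<in>{0..CARD('n)}. ereal (sgn_norm l y) - ereal (real l))"
      by (rule SUP_upper2[of "l0 x"]) (auto simp: l0_le_CARD caprac_le_sgn_norm)
  qed
next
  show "(SUP l\<in>{0..CARD('n)}. ereal (sgn_norm l y) - ereal (real l))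
      \<le> conjugate caprac (\<lambda>x. ereal (real (l0 x))) y"
  proof (rule SUP_least)
    fix l
    obtain x where x: "l0 x \<le> l" "caprac x y = sgn_norm l y"
      by (rule caprac_attains_sgn_norm)
    \<comment> \<open>The maximiser may have fewer than \<open>l\<close> nonzero components; this
      only increases the right-hand side.\<close>
    then have "ereal (sgn_norm l y) - ereal (real l) \<le> ereal (caprac x y) - ereal (real (l0 x))"
      by simp
    also have "\<dots> \<le> conjugate caprac (\<lambda>x. ereal (real (l0 x))) y"
      by (rule conjugate_upper)
    finally show "ereal (sgn_norm l y) - ereal (real l) \<le> conjugate caprac (\<lambda>x. ereal (real (l0 x))) y" .
  qed
qed

section \<open>Biconjugates\<close>

lemma biconjugate_char_fun_l0_level:
  "biconjugate caprac (char_fun (l0_level k)) x = char_fun (l0_level k) x"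
proof (rule antisym[OF biconjugate_le])
  let ?B = "biconjugate caprac (char_fun (l0_level k)) x"
  have *: "ereal (t * (norm x - sgn_norm k x)) \<le> ?B" if "0 \<le> t" for t
  proof -
    have "ereal (t * (norm x - sgn_norm k x))
        \<le> ereal (caprac x (t *\<^sub>R x)) - conjugate caprac (char_fun (l0_level k)) (t *\<^sub>R x)"
      using sgn_norm_scaleR_le[OF that, of k x]
      by (simp add: conjugate_char_fun_l0_level caprac_scaleR_self right_diff_distrib)
    also have "\<dots> \<le> ?B"
      by (rule biconjugate_upper)
    finally show ?thesis .
  qed
  show "char_fun (l0_level k) x \<le> ?B"
  proof (cases "l0 x \<le> k")
    case True
    then show ?thesis
      using *[of 0] by (simp add: char_fun_def l0_level_def zero_ereal_def)
  next
    case False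
    then have gap: "0 < norm x - sgn_norm k x"
      using sgn_norm_less_norm[of k x] by simp
    have "ereal r \<le> ?B" for r
    proof -
      \<comment> \<open>The factor \<open>t\<close> is chosen so that the bound in \<open>*\<close>
        equals \<open>\<bar>r\<bar>\<close>.\<close>
      have "ereal r \<le> ereal (\<bar>r\<bar> / (norm x - sgn_norm k x) * (norm x - sgn_norm k x))"
        using gap by simp
      also have "\<dots> \<le> ?B"
        using gap by (intro *) simp
      finally show ?thesis .
    qed
    then have "?B = \<infinity>"
      by (intro ereal_top)
    then show ?thesis
      by simp
  qed
qed

text \<open>Here a single finite \<open>t\<close> is enough: one test vector already gives the value
  \<open>l0 x\<close>.\<close>

lemma biconjugate_l0:
  fixes x :: "real ^ 'n"
  shows "biconjugate caprac (\<lambda>x. ereal (real (l0 x))) x = ereal (real (l0 x))"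
proof (rule antisym[OF biconjugate_le])
  let ?f = "\<lambda>x :: real ^ 'n. ereal (real (l0 x))"
  obtain t where t: "0 \<le> t" "\<And>l. l < l0 x \<Longrightarrow> real (l0 x) \<le> t * (norm x - sgn_norm l x)"
  proof (cases "l0 x = 0")
    case True
    then show ?thesis
      using that[of 0] by simp
  next
    case False
    \<comment> \<open>Gauge norms increase with the index, so among all \<open>l < l0 x\<close> the
      gap is smallest at \<open>l0 x - 1\<close>. One \<open>t\<close> thus serves every such
      \<open>l\<close>.\<close>
    define gap where "gap = norm x - sgn_norm (l0 x - 1) x"
    have gap: "0 < gap"
      using False sgn_norm_less_norm[of "l0 x - 1" x] by (simp add: gap_def)
    show ?thesis
    proof (rule that[of "real (l0 x) / gap"])
      fix l assume "l < l0 x"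
      then have "gap \<le> norm x - sgn_norm l x"
        using sgn_norm_mono[of l "l0 x - 1" x] by (simp add: gap_def)
      then have "real (l0 x) / gap * gap \<le> real (l0 x) / gap * (norm x - sgn_norm l x)"
        using gap by (intro mult_left_mono) auto
      then show "real (l0 x) \<le> real (l0 x) / gap * (norm x - sgn_norm l x)"
        using gap by simp
    qed (use gap in simp)
  qed
  \<comment> \<open>For \<open>l < l0 x\<close> the choice of \<open>t\<close> pays for
    \<open>l0 x\<close>; for larger \<open>l\<close> the penalty \<open>l\<close> is already at
    least \<open>l0 x\<close>.\<close>
  have "sgn_norm l (t *\<^sub>R x) - real l \<le> t * norm x - real (l0 x)" for l
  proof (cases "l < l0 x")
    case True
    then show ?thesis
      using t(2)[of l] sgn_norm_scaleR_le[OF t(1), of l x] by (simp add: right_diff_distrib)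
  next
    case False
    then show ?thesis
      using sgn_norm_le_norm[of l "t *\<^sub>R x"] t(1) by simp
  qed
  then have "conjugate caprac ?f (t *\<^sub>R x) \<le> ereal (t * norm x - real (l0 x))"
    unfolding conjugate_l0 by (intro SUP_least) simp
  then have "ereal (real (l0 x)) \<le> ereal (caprac x (t *\<^sub>R x)) - conjugate caprac ?f (t *\<^sub>R x)"
    by (cases "conjugate caprac ?f (t *\<^sub>R x)") (auto simp: caprac_scaleR_self)
  also have "\<dots> \<le> biconjugate caprac ?f x"
    by (rule biconjugate_upper)
  finally show "ereal (real (l0 x)) \<le> biconjugate caprac ?f x" .
qed

theorem theorem8:
  fixes k :: nat
  assumes "k \<le> CARD('n::finite)"
  shows
    "conjugate (\<lambda>x y. - caprac x y) (char_fun (l0_level k)) =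
       conjugate caprac (char_fun (l0_level k :: (real ^ 'n) set)) \<and>
     conjugate caprac (char_fun (l0_level k)) = (\<lambda>y :: real ^ 'n. ereal (sgn_norm k y)) \<and>
     biconjugate caprac (char_fun (l0_level k)) = char_fun (l0_level k :: (real ^ 'n) set) \<and>
     conjugate caprac (\<lambda>x. ereal (real (l0 x))) =
       (\<lambda>y :: real ^ 'n. SUP l\<in>{0..CARD('n)}. ereal (sgn_norm l y) - ereal (real l)) \<and>
     biconjugate caprac (\<lambda>x. ereal (real (l0 x))) = (\<lambda>x :: real ^ 'n. ereal (real (l0 x)))"
proof (intro conjI)
  show "conjugate (\<lambda>x y. - caprac x y) (char_fun (l0_level k)) =
      conjugate caprac (char_fun (l0_level k :: (real ^ 'n) set))"
    by (rule conjugate_char_fun_uminus) (simp add: l0_level_def l0_minus)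
qed (simp_all only: fun_eq_iff conjugate_char_fun_l0_level biconjugate_char_fun_l0_level
  conjugate_l0 biconjugate_l0 simp_thms)

end
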